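(* Let $G$ be a finite group. The set of dominant vertices in the CCC-graph (commuting conjugacy class graph) of $G$ is the set of central conjugacy classes of $G$, i.e. the set of classes $z^G=\{z\}$ with $z\in Z(G)$.
   Context: For a group $G$ and $a\in G$, $a^G$ denotes the conjugacy class of $a$ in $G$. The CCC-graph of $G$ is the simple undirected graph whose vertices are all the conjugacy classes of $G$, in which two distinct vertices $a^G$ and $b^G$ are adjacent if and only if there exist $x\in a^G$ and $y\in b^G$ such that $\langle x,y\rangle$ is abelian (equivalently, $xy=yx$). A dominant vertex of a graph is a vertex that is adjacent to all other vertices. $Z(G)$ is the centre of $G$. *)

theory Defs
  imports "HOL-Algebra.Elementary_Groups" "Graph_Theory.Pair_Digraph"
begin

definition conjugacy_class :: "('a, 'b) monoid_scheme \<Rightarrow> 'a \<Rightarrow> 'a set" where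
  "conjugacy_class G a = {inv\<^bsub>G\<^esub> g \<otimes>\<^bsub>G\<^esub> a \<otimes>\<^bsub>G\<^esub> g | g. g \<in> carrier G}"

definition conjugacy_classes :: "('a, 'b) monoid_scheme \<Rightarrow> 'a set set" where
  "conjugacy_classes G = conjugacy_class G ` carrier G"

definition group_center :: "('a, 'b) monoid_scheme \<Rightarrow> 'a set" where
  "group_center G = {z \<in> carrier G. \<forall>g\<in>carrier G. z \<otimes>\<^bsub>G\<^esub> g = g \<otimes>\<^bsub>G\<^esub> z}"

text \<open>
  As usual in \<^theory>\<open>Graph_Theory.Pair_Digraph\<close>, an undirected graph is represented by its
  symmetric arc set: an edge between two vertices is the pair of opposite arcs
  joining them. The lemma \<open>pair_graph_ccc_graph\<close> below shows that the
  CCC-graph of a finite group is a simple undirected graph in that sense.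
\<close>

definition ccc_graph :: "('a, 'b) monoid_scheme \<Rightarrow> 'a set pair_pre_digraph" where
  "ccc_graph G =
    \<lparr> pverts = conjugacy_classes G,
      parcs = {(A, B). A \<in> conjugacy_classes G \<and> B \<in> conjugacy_classes G \<and> A \<noteq> B \<and>
        (\<exists>x\<in>A. \<exists>y\<in>B. comm_group (subgroup_generated G {x, y}))} \<rparr>"

definition dominant_vertices :: "'v pair_pre_digraph \<Rightarrow> 'v set" where
  "dominant_vertices \<Gamma> = {v \<in> pverts \<Gamma>. \<forall>w\<in>pverts \<Gamma> - {v}. (v, w) \<in> parcs \<Gamma>}"

lemma pair_graph_ccc_graph:
  assumes "finite (carrier G)"
  shows "pair_graph (ccc_graph G)"
proof -
  have fin: "finite (conjugacy_classes G)"
    using assms by (simp add: conjugacy_classes_def)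
  show ?thesis
  proof unfold_locales
    show "finite (parcs (ccc_graph G))"
      by (rule finite_subset[OF _ finite_cartesian_product[OF fin fin]])
        (auto simp: ccc_graph_def)
    show "symmetric (with_proj (ccc_graph G))"
      unfolding symmetric_def sym_def
      by (simp add: ccc_graph_def arcs_ends_def arc_to_ends_def) (metis insert_commute)
  qed (auto simp: ccc_graph_def fin)
qed

end

theory Submission
  imports Defs
begin

text \<open>
  A central class commutes with everything, so it is dominant. Conversely, let the class of \<open>a\<close>
  be dominant. Then every \<open>b\<close> has a conjugate commuting with a conjugate of \<open>a\<close>; conjugating both,
  \<open>b\<close> lies in a conjugate of the centralizer \<open>C\<close> of \<open>a\<close>
  (\<open>commuting_conjugates_imp_conjugate_in_centralizer\<close>). Hence the conjugates of \<open>C\<close> cover the group,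
  and since a finite group is not covered by the conjugates of a proper subgroup
  (\<open>conjugates_cover_imp_eq_carrier\<close>), \<open>C\<close> is the whole group, that is, \<open>a\<close> is central.

  Adjacency is phrased through the subgroup generated by two elements being abelian;
  \<open>comm_group_subgroup_generated_pair_iff\<close> turns this into the two elements commuting.
\<close>

definition centralizer :: "('a, 'b) monoid_scheme \<Rightarrow> 'a set \<Rightarrow> 'a set" where
  "centralizer G S = {g \<in> carrier G. \<forall>s\<in>S. g \<otimes>\<^bsub>G\<^esub> s = s \<otimes>\<^bsub>G\<^esub> g}"

lemma (in group) subgroup_centralizer:
  assumes "S \<subseteq> carrier G"
  shows "subgroup (centralizer G S) G"
proof (rule subgroupI)
  show "centralizer G S \<noteq> {}"
    using assms by (force simp: centralizer_def)
next
  fix g assume "g \<in> centralizer G S"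
  then have g: "g \<in> carrier G" and comm: "\<And>s. s \<in> S \<Longrightarrow> g \<otimes> s = s \<otimes> g"
    by (auto simp: centralizer_def)
  have "inv g \<otimes> s = s \<otimes> inv g" if "s \<in> S" for s
  proof -
    have s: "s \<in> carrier G"
      using that assms by blast
    have "inv g \<otimes> s = inv g \<otimes> (s \<otimes> g) \<otimes> inv g"
      using g s by (simp add: m_assoc)
    also have "\<dots> = inv g \<otimes> (g \<otimes> s) \<otimes> inv g"
      using comm that by simp
    also have "\<dots> = s \<otimes> inv g"
      using g s by (simp add: m_assoc [symmetric])
    finally show ?thesis .
  qed
  with g show "inv g \<in> centralizer G S"
    by (simp add: centralizer_def)
next
  fix g h assume "g \<in> centralizer G S" "h \<in> centralizer G S"
  with assms show "g \<otimes> h \<in> centralizer G S"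
    unfolding centralizer_def by (smt (verit) m_assoc m_closed mem_Collect_eq subsetD)
qed (auto simp: centralizer_def)

text \<open>
  The centralizer of \<open>S\<close> is a subgroup containing \<open>S\<close>, hence contains the generated subgroup.
  Read the other way round, \<open>S\<close> centralizes the generated subgroup, and the same
  argument applies once more.
\<close>

lemma (in group) generate_subset_centralizer_generate:
  assumes S: "S \<subseteq> carrier G" and comm: "S \<subseteq> centralizer G S"
  shows "generate G S \<subseteq> centralizer G (generate G S)"
proof -
  have "generate G S \<subseteq> centralizer G S"
    using generate_subgroup_incl[OF comm subgroup_centralizer[OF S]] .
  then have "S \<subseteq> centralizer G (generate G S)"
    using S unfolding centralizer_def by (smt (verit) mem_Collect_eq subset_eq)
  then show ?thesis
    using generate_subgroup_incl subgroup_centralizer generate_in_carrier S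
    by (meson subsetI)
qed

lemma (in group) comm_group_subgroup_generated_pair_iff:
  assumes "x \<in> carrier G" "y \<in> carrier G"
  shows "comm_group (subgroup_generated G {x, y}) \<longleftrightarrow> x \<otimes> y = y \<otimes> x"
proof
  assume "comm_group (subgroup_generated G {x, y})"
  then interpret H: comm_group "subgroup_generated G {x, y}" .
  have "x \<in> carrier (subgroup_generated G {x, y})" "y \<in> carrier (subgroup_generated G {x, y})"
    using assms by (auto simp: carrier_subgroup_generated intro: generate.incl)
  then show "x \<otimes> y = y \<otimes> x"
    using H.m_comm by simp
next
  assume "x \<otimes> y = y \<otimes> x"
  then have "{x, y} \<subseteq> centralizer G {x, y}"
    using assms by (auto simp: centralizer_def)
  then have "generate G {x, y} \<subseteq> centralizer G (generate G {x, y})"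
    using assms by (intro generate_subset_centralizer_generate) auto
  moreover have "carrier (subgroup_generated G {x, y}) = generate G {x, y}"
    using assms by (simp add: carrier_subgroup_generated)
  ultimately show "comm_group (subgroup_generated G {x, y})"
    by (intro group.group_comm_groupI group_subgroup_generated) (auto simp: centralizer_def)
qed

text \<open>
  The conjugate of \<open>H\<close> by \<open>g\<close> depends only on the coset of \<open>g\<close>, so there are at most
  \<open>n = [G : H]\<close> conjugates. All of them contain the identity, so together they have at most
  \<open>n * (|H| - 1) = |G| - n\<close> elements other than the identity. If they cover the
  \<open>|G| - 1\<close> such elements of the group, then \<open>n = 1\<close>.
\<close>

lemma (in group) conjugates_cover_imp_eq_carrier:
  assumes fin: "finite (carrier G)" and H: "subgroup H G"
    and cover: "\<And>b. b \<in> carrier G \<Longrightarrow> \<exists>g\<in>carrier G. \<exists>h\<in>H. b = inv g \<otimes> h \<otimes> g"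
  shows "H = carrier G"
proof -
  define r where "r C = (SOME g. g \<in> carrier G \<and> C = H #> g)" for C
  define nonid_conj where "nonid_conj C = (\<lambda>h. inv r C \<otimes> h \<otimes> r C) ` (H - {\<one>})" for C
  have H_sub: "H \<subseteq> carrier G" and finH: "finite H" and oneH: "\<one> \<in> H"
    using H fin by (auto dest: subgroup.subset subgroup.one_closed finite_subset)
  have r: "r C \<in> carrier G \<and> C = H #> r C" if "C \<in> rcosets H" for C
  proof -
    have "\<exists>g. g \<in> carrier G \<and> C = H #> g"
      using that by (auto simp: RCOSETS_def)
    then show ?thesis
      unfolding r_def by (rule someI_ex)
  qed
  have fin_cosets: "finite (rcosets H)"
    using fin by (simp add: RCOSETS_def)
  have "carrier G - {\<one>} \<subseteq> (\<Union>C\<in>rcosets H. nonid_conj C)"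
  proof
    fix b assume b: "b \<in> carrier G - {\<one>}"
    then obtain g h where g: "g \<in> carrier G" and h: "h \<in> H" and bgh: "b = inv g \<otimes> h \<otimes> g"
      using cover[of b] by auto
    obtain C where C: "C \<in> rcosets H" and "g \<in> C"
      using rcosetsI[OF H_sub g] rcos_self[OF g H] by blast
    then have "g \<in> H #> r C"
      using equalityD1[OF conjunct2[OF r[OF C]]] by (rule_tac subsetD)
    then obtain k where k: "k \<in> H" and gk: "g = k \<otimes> r C"
      by (auto simp: r_coset_def)
    have car: "k \<in> carrier G" "h \<in> carrier G" "r C \<in> carrier G"
      using k h H_sub r[OF C] by auto
    \<comment> \<open>Absorb the factor \<open>k\<close> into \<open>H\<close>, to conjugate by the chosen representative of the coset.\<close>
    have eq: "b = inv r C \<otimes> (inv k \<otimes> h \<otimes> k) \<otimes> r C"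
      using car by (simp add: bgh gk inv_mult_group m_assoc)
    moreover have "inv k \<otimes> h \<otimes> k \<noteq> \<one>"
      using eq b car by auto
    moreover have "inv k \<otimes> h \<otimes> k \<in> H"
      using H h k by (simp add: subgroup.m_closed subgroup.m_inv_closed)
    ultimately show "b \<in> (\<Union>C\<in>rcosets H. nonid_conj C)"
      using C unfolding nonid_conj_def by blast
  qed
  then have "card (carrier G - {\<one>}) \<le> card (\<Union>C\<in>rcosets H. nonid_conj C)"
    using fin_cosets finH by (intro card_mono) (auto simp: nonid_conj_def)
  also have "\<dots> \<le> (\<Sum>C\<in>rcosets H. card (nonid_conj C))"
    by (rule card_UN_le[OF fin_cosets])
  also have "\<dots> \<le> (\<Sum>C\<in>rcosets H. card H - 1)"
    unfolding nonid_conj_def using finH oneH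
    by (intro sum_mono) (metis card_Diff_singleton card_image_le finite_Diff)
  also have "\<dots> = card (rcosets H) * card H - card (rcosets H)"
    by (simp add: diff_mult_distrib2)
  also have "\<dots> = card (carrier G) - card (rcosets H)"
    using lagrange[OF H] by (simp add: order_def)
  finally have "card (carrier G) - 1 \<le> card (carrier G) - card (rcosets H)"
    using fin by simp
  moreover have pos: "card (carrier G) > 0"
    using fin by (auto simp: card_gt_0_iff)
  moreover have lag: "card (rcosets H) * card H = card (carrier G)"
    using lagrange[OF H] by (simp add: order_def)
  moreover have "card (rcosets H) > 0"
    using pos lag by (cases "card (rcosets H)") auto
  moreover have "card (rcosets H) \<le> card (carrier G)"
    using pos lag by (cases "card H") auto
  ultimately have "card (rcosets H) = 1"
    by linarith
  with lag show ?thesis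
    using card_subset_eq[OF fin H_sub] by simp
qed

lemma (in group) conjugacy_class_self:
  assumes "a \<in> carrier G"
  shows "a \<in> conjugacy_class G a"
  using assms by (force simp: conjugacy_class_def)

lemma (in group) conjugacy_class_subset_carrier:
  assumes "a \<in> carrier G"
  shows "conjugacy_class G a \<subseteq> carrier G"
  using assms by (auto simp: conjugacy_class_def)

lemma (in group) conjugacy_class_central:
  assumes "z \<in> group_center G"
  shows "conjugacy_class G z = {z}"
proof -
  have z: "z \<in> carrier G" and comm: "\<And>g. g \<in> carrier G \<Longrightarrow> z \<otimes> g = g \<otimes> z"
    using assms by (auto simp: group_center_def)
  have "inv g \<otimes> z \<otimes> g = z" if "g \<in> carrier G" for g
    using that z comm[of g] by (simp add: m_assoc) (simp add: m_assoc[symmetric])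
  then show ?thesis
    using z unfolding conjugacy_class_def by force
qed

text \<open>
  Conjugating the commuting pair so that \<open>x\<close> becomes \<open>a\<close> turns \<open>y\<close> into a conjugate
  of \<open>b\<close> that commutes with \<open>a\<close>.
\<close>

lemma (in group) commuting_conjugates_imp_conjugate_in_centralizer:
  assumes a: "a \<in> carrier G" and b: "b \<in> carrier G"
    and x: "x \<in> conjugacy_class G a" and y: "y \<in> conjugacy_class G b"
    and comm: "x \<otimes> y = y \<otimes> x"
  shows "\<exists>g\<in>carrier G. \<exists>h\<in>centralizer G {a}. b = inv g \<otimes> h \<otimes> g"
proof -
  obtain g where g: "g \<in> carrier G" and xg: "x = inv g \<otimes> a \<otimes> g"
    using x by (auto simp: conjugacy_class_def)
  obtain k where k: "k \<in> carrier G" and yk: "y = inv k \<otimes> b \<otimes> k"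
    using y by (auto simp: conjugacy_class_def)
  define h where "h = g \<otimes> y \<otimes> inv g"
  have car: "x \<in> carrier G" "y \<in> carrier G" "h \<in> carrier G"
    using xg yk g k a b by (auto simp: h_def)
  have ag: "a = g \<otimes> x \<otimes> inv g"
    using a g by (simp add: xg m_assoc) (simp add: m_assoc[symmetric])
  have cancel: "(g \<otimes> u \<otimes> inv g) \<otimes> (g \<otimes> v \<otimes> inv g) = g \<otimes> (u \<otimes> v) \<otimes> inv g"
    if "u \<in> carrier G" "v \<in> carrier G" for u v
    using that g by (simp add: m_assoc) (simp add: m_assoc[symmetric])
  have "h \<otimes> a = a \<otimes> h"
    unfolding h_def ag using car comm by (simp add: cancel)
  then have "h \<in> centralizer G {a}"
    using car by (simp add: centralizer_def)
  moreover have "b = inv (g \<otimes> inv k) \<otimes> h \<otimes> (g \<otimes> inv k)"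
  proof -
    have "b = k \<otimes> y \<otimes> inv k"
      using k b unfolding yk by (simp add: m_assoc) (simp add: m_assoc[symmetric])
    also have "y = inv g \<otimes> h \<otimes> g"
      using g car unfolding h_def by (simp add: m_assoc) (simp add: m_assoc[symmetric])
    finally show ?thesis
      using g k car by (simp add: inv_mult_group m_assoc)
  qed
  moreover have "g \<otimes> inv k \<in> carrier G"
    using g k by simp
  ultimately show ?thesis
    by blast
qed

lemma (in group) dominant_vertex_imp_central:
  assumes fin: "finite (carrier G)" and a: "a \<in> carrier G"
    and dom: "conjugacy_class G a \<in> dominant_vertices (ccc_graph G)"
  shows "a \<in> group_center G"
proof -
  have "\<exists>x\<in>conjugacy_class G a. \<exists>y\<in>conjugacy_class G b. x \<otimes> y = y \<otimes> x"
    if b: "b \<in> carrier G" for b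
  \<comment> \<open>The graph has no loops, so dominance says nothing about conjugates \<open>b\<close> of \<open>a\<close>; for these
    \<open>a\<close> itself lies in both classes.\<close>
  proof (cases "conjugacy_class G a = conjugacy_class G b")
    case True
    then show ?thesis
      using conjugacy_class_self[OF a] by auto
  next
    case False
    then have "\<exists>x\<in>conjugacy_class G a. \<exists>y\<in>conjugacy_class G b.
        comm_group (subgroup_generated G {x, y})"
      using dom b by (auto simp: dominant_vertices_def ccc_graph_def conjugacy_classes_def)
    then show ?thesis
      using comm_group_subgroup_generated_pair_iff conjugacy_class_subset_carrier a b
      by (meson subsetD)
  qed
  then have "\<exists>g\<in>carrier G. \<exists>h\<in>centralizer G {a}. b = inv g \<otimes> h \<otimes> g"
    if "b \<in> carrier G" for b
    using commuting_conjugates_imp_conjugate_in_centralizer[OF a that] that by meson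
  then have "centralizer G {a} = carrier G"
    using a by (intro conjugates_cover_imp_eq_carrier fin subgroup_centralizer) auto
  then show ?thesis
    using a unfolding centralizer_def group_center_def by force
qed

lemma (in group) central_imp_dominant_vertex:
  assumes z: "z \<in> group_center G"
  shows "conjugacy_class G z \<in> dominant_vertices (ccc_graph G)"
proof -
  have zc: "z \<in> carrier G"
    using z by (simp add: group_center_def)
  have "\<exists>x\<in>conjugacy_class G z. \<exists>y\<in>conjugacy_class G b. comm_group (subgroup_generated G {x, y})"
    if b: "b \<in> carrier G" for b
  proof (intro bexI)
    show "comm_group (subgroup_generated G {z, b})"
      using comm_group_subgroup_generated_pair_iff[OF zc b] z b by (simp add: group_center_def)
  qed (simp_all add: conjugacy_class_self zc b)
  then show ?thesis
    using zc by (auto simp: dominant_vertices_def ccc_graph_def conjugacy_classes_def)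
qed

theorem proposition2p5:
  fixes G :: "('a, 'b) monoid_scheme"
  assumes "group G" and "finite (carrier G)"
  shows "dominant_vertices (ccc_graph G) = {conjugacy_class G z | z. z \<in> group_center G}
    \<and> (\<forall>z\<in>group_center G. conjugacy_class G z = {z})"
proof -
  interpret group G
    by fact
  have "\<exists>a\<in>carrier G. A = conjugacy_class G a" if "A \<in> dominant_vertices (ccc_graph G)" for A
    using that by (auto simp: dominant_vertices_def ccc_graph_def conjugacy_classes_def)
  then show ?thesis
    using dominant_vertex_imp_central[OF assms(2)] central_imp_dominant_vertex
      conjugacy_class_central by blast
qed

end
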